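(* The Ammann set $\mathcal{T}$ of 16 Wang tiles, consisting of the following tuples (east, north, west, south), $$(1,1,2,2),$$ $$(4,2,6,1),\ (5,2,3,1),\ (3,2,6,2),\ (5,1,4,1),$$ $$(2,4,1,6),\ (2,5,1,3),\ (2,3,2,6),\ (1,5,1,4),$$ $$(3,3,4,4),\ (4,4,5,5),\ (6,6,3,3),\ (4,3,4,5),\ (6,3,4,3),\ (3,4,5,4),\ (3,6,3,4),$$ admits no periodic tiling, i.e. no valid configuration $w:\mathbb{Z}^2\to\mathcal{T}$ is periodic.
   Context: A Wang tile is a tuple $(a,b,c,d)$ where $a,b,c,d$ are the labels of the right (east), top (north), left (west) and bottom (south) edges of a unit square. For a finite set $\mathcal{T}$ of Wang tiles, a configuration $w:\mathbb{Z}^2\to\mathcal{T}$ is valid if for all $n\in\mathbb{Z}^2$ the east label of $w_n$ equals the west label of $w_{n+(1,0)}$ and the north label of $w_n$ equals the south label of $w_{n+(0,1)}$. It is periodic if there is $p\in\mathbb{Z}^2\setminus\{0\}$ with $w_{n+p}=w_n$ for all $n$. *)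

theory Defs
  imports Main "HOL-Library.Product_Plus"
begin

type_synonym 'a wang_tile = "'a \<times> 'a \<times> 'a \<times> 'a"

text \<open>The labels are listed in the order east, north, west, south.\<close>

fun east :: "'a wang_tile \<Rightarrow> 'a" where "east (a, b, c, d) = a"
fun north :: "'a wang_tile \<Rightarrow> 'a" where "north (a, b, c, d) = b"
fun west :: "'a wang_tile \<Rightarrow> 'a" where "west (a, b, c, d) = c"
fun south :: "'a wang_tile \<Rightarrow> 'a" where "south (a, b, c, d) = d"

definition valid_configuration :: "'a wang_tile set \<Rightarrow> (int \<times> int \<Rightarrow> 'a wang_tile) \<Rightarrow> bool" where
  "valid_configuration T w \<longleftrightarrow>
     (\<forall>n. w n \<in> T) \<and>
     (\<forall>n. east (w n) = west (w (n + (1, 0)))) \<and>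
     (\<forall>n. north (w n) = south (w (n + (0, 1))))"

text \<open>A single nonzero period suffices; two independent ones are not required.\<close>

definition periodic :: "(int \<times> int \<Rightarrow> 'b) \<Rightarrow> bool" where
  "periodic w \<longleftrightarrow> (\<exists>p. p \<noteq> 0 \<and> (\<forall>n. w (n + p) = w n))"

definition ammann_tiles :: "nat wang_tile set" where
  "ammann_tiles =
     {(1,1,2,2),
      (4,2,6,1), (5,2,3,1), (3,2,6,2), (5,1,4,1),
      (2,4,1,6), (2,5,1,3), (2,3,2,6), (1,5,1,4),
      (3,3,4,4), (4,4,5,5), (6,6,3,3), (4,3,4,5), (6,3,4,3), (3,4,5,4), (3,6,3,4)}"

end

theory Submission
  imports Defs
begin

text \<open>
  Labels 1 and 2 mark narrow rows and columns, labels 3 to 6 wide ones, and the kind of a row or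
  column is constant along it. For any integers \<open>s\<close>, \<open>t\<close> there are potentials on the vertical and
  horizontal labels whose total flux out of a tile depends only on the kinds of its row and column.
  If \<open>p\<close> is a period with \<open>q = snd p > 0\<close>, let \<open>a\<close> and \<open>b\<close> count the narrow and the wide rows among
  \<open>q\<close> consecutive ones. For \<open>s = a + b\<close>, \<open>t = a + 2 b\<close> the flux out of every column segment of
  height \<open>q\<close> is the same number \<open>a\<^sup>2 + a b - b\<^sup>2\<close>. Up to telescoping along the horizontal shift
  \<open>fst p\<close>, the flux through the left side of the segment thus grows linearly in the horizontal
  coordinate; being bounded, it has slope 0. This forces \<open>a = b = 0\<close>, as the golden ratio
  is irrational. Periods with \<open>q = 0\<close> are handled by reflection in the diagonal.
\<close>

text \<open>Infinite descent: modulo 2, \<open>a * (a + b) = b * b\<close> forces both numbers to be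
  even, and their halves solve the same equation.\<close>

lemma golden_ratio_irrational_nat:
  fixes a b :: nat
  assumes "a * a + a * b = b * b"
  shows "a = 0 \<and> b = 0"
  using assms
proof (induction b arbitrary: a rule: less_induct)
  case (less b)
  have "even (a * a + a * b) \<longleftrightarrow> even (b * b)"
    using less.prems by simp
  then have "even a" "even b"
    by auto
  then obtain c d where cd: "a = 2 * c" "b = 2 * d"
    by (auto elim!: evenE)
  then have "c * c + c * d = d * d"
    using less.prems by simp
  then show ?case
    using less.IH[of d c] cd less.prems by (cases "b = 0") auto
qed

lemma bounded_linear_growth_eq_0:
  fixes F :: "int \<Rightarrow> int"
  assumes step: "\<And>x. F (x + 1) = F x + k" and bound: "\<And>x. \<bar>F x\<bar> \<le> B"
  shows "k = 0"
proof (rule ccontr)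
  assume "k \<noteq> 0"
  have F: "F (int n) = F 0 + int n * k" for n
  proof (induction n)
    case (Suc n)
    then show ?case
      using step[of "int n"] by (simp add: algebra_simps)
  qed simp
  \<comment> \<open>Two values of \<open>F\<close> differ by at most \<open>2 * B\<close>, which
    \<open>2 * B + 1\<close> equal increments of size at least 1 exceed.\<close>
  define n where "n = nat (2 * B + 1)"
  have "B \<ge> 0"
    using bound[of 0] by simp
  then have "2 * B + 1 \<le> int n * \<bar>k\<bar>"
    using \<open>k \<noteq> 0\<close> mult_left_mono[of 1 "\<bar>k\<bar>" "int n"] by (simp add: n_def)
  also have "\<dots> = \<bar>F (int n) - F 0\<bar>"
    by (simp add: F abs_mult)
  also have "\<dots> \<le> 2 * B"
    using bound[of 0] bound[of "int n"] by linarith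
  finally show False
    by simp
qed

text \<open>A sliding window sum telescopes: \<open>G x\<close> is the sum of \<open>g\<close> over
  x, ..., x + m - 1 if m > 0, and minus the sum over x + m, ..., x - 1 if m < 0.\<close>

lemma shift_difference_bounded_primitive:
  fixes g :: "int \<Rightarrow> int"
  assumes g: "\<And>x. \<bar>g x\<bar> \<le> M"
  shows "\<exists>G B. (\<forall>x. G (x + 1) - G x = g (x + m) - g x) \<and> (\<forall>x. \<bar>G x :: int\<bar> \<le> B)"
proof (induction m rule: int_induct[where k = 0])
  case base
  show ?case
    by (rule exI[of _ "\<lambda>_. 0"]) auto
next
  case (step1 i)
  then obtain G B where G: "\<And>x. G (x + 1) - G x = g (x + i) - g x" "\<And>x. \<bar>G x\<bar> \<le> B"
    by blast
  have "\<bar>G x + g (x + i)\<bar> \<le> B + M" for x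
    using G(2)[of x] g[of "x + i"] by linarith
  moreover have "(G (x + 1) + g (x + 1 + i)) - (G x + g (x + i)) = g (x + (i + 1)) - g x" for x
    using G(1)[of x] by (simp add: algebra_simps)
  ultimately show ?case
    by (intro exI[of _ "\<lambda>x. G x + g (x + i)"] exI[of _ "B + M"]) blast
next
  case (step2 i)
  then obtain G B where G: "\<And>x. G (x + 1) - G x = g (x + i) - g x" "\<And>x. \<bar>G x\<bar> \<le> B"
    by blast
  have "\<bar>G x - g (x + (i - 1))\<bar> \<le> B + M" for x
    using G(2)[of x] g[of "x + (i - 1)"] by linarith
  moreover have "(G (x + 1) - g (x + 1 + (i - 1))) - (G x - g (x + (i - 1))) = g (x + (i - 1)) - g x"
    for x
    using G(1)[of x] by (simp add: algebra_simps)
  ultimately show ?case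
    by (intro exI[of _ "\<lambda>x. G x - g (x + (i - 1))"] exI[of _ "B + M"]) blast
qed

text \<open>Opposite edges of a tile are of the same kind, so only differences within a kind matter.
  One narrow and one wide label may thus get the value 0: here 1 and 6, and 1 and 4 for the
  horizontal potential.\<close>

definition vertical_potential :: "int \<Rightarrow> int \<Rightarrow> nat \<Rightarrow> int" where
  "vertical_potential s t l =
     (if l = 2 then - t else if l = 3 then t else if l = 4 then s else if l = 5 then s + t else 0)"

definition horizontal_potential :: "int \<Rightarrow> int \<Rightarrow> nat \<Rightarrow> int" where
  "horizontal_potential s t l =
     (if l = 2 then t - s else if l = 3 then - t else if l = 5 then s - t else if l = 6 then - s else 0)"

lemma abs_vertical_potential_le: "\<bar>vertical_potential s t l\<bar> \<le> \<bar>s\<bar> + \<bar>t\<bar>"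
  by (auto simp: vertical_potential_def)

lemma abs_horizontal_potential_le: "\<bar>horizontal_potential s t l\<bar> \<le> \<bar>s\<bar> + \<bar>t\<bar>"
  by (auto simp: horizontal_potential_def)

text \<open>The south label shows the kind of the column, the west label that of the row. The
  potentials solve the sixteen linear equations that result.\<close>

lemma ammann_tile_flux:
  assumes "\<tau> \<in> ammann_tiles"
  shows "vertical_potential s t (north \<tau>) - vertical_potential s t (south \<tau>)
           + horizontal_potential s t (east \<tau>) - horizontal_potential s t (west \<tau>)
         = (if south \<tau> \<le> 2 then if west \<tau> \<le> 2 then s else s - t
            else if west \<tau> \<le> 2 then t else - s)"
  using assms unfolding ammann_tiles_def
  by (elim insertE emptyE) (simp_all add: vertical_potential_def horizontal_potential_def)

lemma ammann_tile_narrow: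
  assumes "\<tau> \<in> ammann_tiles"
  shows "east \<tau> \<le> 2 \<longleftrightarrow> west \<tau> \<le> 2" "north \<tau> \<le> 2 \<longleftrightarrow> south \<tau> \<le> 2"
  using assms unfolding ammann_tiles_def by (elim insertE emptyE; simp)+

lemma int_const_of_step:
  fixes P :: "int \<Rightarrow> bool"
  assumes "\<And>x. P (x + 1) \<longleftrightarrow> P x"
  shows "P x \<longleftrightarrow> P 0"
proof (induction x rule: int_induct[where k = 0])
  case (step2 i)
  then show ?case
    using assms[of "i - 1"] by simp
qed (use assms in auto)

lemma sum_if_const:
  fixes u v :: int
  shows "(\<Sum>y<q::nat. if P y then u else v)
         = int (card {y. y < q \<and> P y}) * u + int (card {y. y < q \<and> \<not> P y}) * v"
proof -
  have "{..<q} \<inter> {y. P y} = {y. y < q \<and> P y}" "{..<q} \<inter> - {y. P y} = {y. y < q \<and> \<not> P y}"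
    by auto
  then show ?thesis
    by (simp add: sum.If_cases)
qed

lemma no_period_upwards:
  assumes valid: "valid_configuration ammann_tiles w"
    and period: "\<And>n. w (n + (m, int q)) = w n"
  shows "q = 0"
proof -
  have tile: "w n \<in> ammann_tiles" for n
    using valid unfolding valid_configuration_def by blast
  have east: "east (w (x, y)) = west (w (x + 1, y))" for x y
    using valid by (force simp: valid_configuration_def)
  have north: "north (w (x, y)) = south (w (x, y + 1))" for x y
    using valid by (force simp: valid_configuration_def)
  define R where "R y \<longleftrightarrow> west (w (0, int y)) \<le> 2" for y
  have row: "west (w (x, int y)) \<le> 2 \<longleftrightarrow> R y" for x y
    unfolding R_def
    by (rule int_const_of_step) (metis ammann_tile_narrow(1) east tile)
  have column: "south (w (x, y)) \<le> 2 \<longleftrightarrow> south (w (x, 0)) \<le> 2" for x y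
    by (rule int_const_of_step) (metis ammann_tile_narrow(2) north tile)
  define a b where "a = card {y. y < q \<and> R y}" and "b = card {y. y < q \<and> \<not> R y}"
  \<comment> \<open>A narrow column segment has flux \<open>a * s + b * (s - t)\<close>, a wide one
    \<open>a * t - b * s\<close>. They agree iff \<open>(a + 2 * b) * s = (a + b) * t\<close>, which
    this choice satisfies; \<open>k\<close> is the common value.\<close>
  define s t where "s = int a + int b" and "t = int a + 2 * int b"
  define k where "k = int a * int a + int a * int b - int b * int b"
  define V where "V = vertical_potential s t"
  define H where "H = horizontal_potential s t"
  define g where "g x = V (south (w (x, 0)))" for x
  define L where "L x = (\<Sum>y<q. H (west (w (x, int y))))" for x
  have flux: "V (south (w (x, int (Suc y)))) - V (south (w (x, int y)))
                + H (west (w (x + 1, int y))) - H (west (w (x, int y)))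
              = (if south (w (x, 0)) \<le> 2 then if R y then s else s - t
                 else if R y then t else - s)" for x y
    using ammann_tile_flux[OF tile, of s t "(x, int y)"]
    by (simp add: V_def H_def east north row column[of x "int y"] add.commute)
  have top: "V (south (w (x, int q))) = g (x - m)" for x
    using period[of "(x - m, 0)"] by (simp add: g_def)
  \<comment> \<open>Inner horizontal edges cancel in the sum over the segment; by periodicity its
    top edge carries the label at the base of column \<open>x - m\<close>.\<close>
  have column_flux: "g (x + - m) - g x + L (x + 1) - L x = k" for x
  proof -
    have "g (x + - m) - g x + L (x + 1) - L x
          = (\<Sum>y<q. V (south (w (x, int (Suc y)))) - V (south (w (x, int y))))
            + (\<Sum>y<q. H (west (w (x + 1, int y)))) - (\<Sum>y<q. H (west (w (x, int y))))"
      using sum_lessThan_telescope[of "\<lambda>y. V (south (w (x, int y)))" q] top[of x]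
      by (simp add: L_def g_def)
    also have "\<dots> = (\<Sum>y<q. if south (w (x, 0)) \<le> 2 then if R y then s else s - t
                              else if R y then t else - s)"
      by (simp only: flux flip: sum.distrib sum_subtractf)
    also have "\<dots> = k"
      by (cases "south (w (x, 0)) \<le> 2")
        (simp_all add: sum_if_const flip: a_def b_def,
         simp_all add: s_def t_def k_def algebra_simps)
    finally show ?thesis .
  qed
  \<comment> \<open>The shift term is absorbed as the increment of a bounded \<open>G\<close>, so
    that \<open>G + L\<close> is bounded with constant increment \<open>k\<close>.\<close>
  obtain G B where G: "\<And>x. G (x + 1) - G x = g (x + - m) - g x" "\<And>x. \<bar>G x\<bar> \<le> B"
    using shift_difference_bounded_primitive[of g "\<bar>s\<bar> + \<bar>t\<bar>" "- m"] abs_vertical_potential_le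
    unfolding g_def V_def by blast
  have L: "\<bar>L x\<bar> \<le> int q * (\<bar>s\<bar> + \<bar>t\<bar>)" for x
  proof -
    have "\<bar>L x\<bar> \<le> (\<Sum>y<q. \<bar>H (west (w (x, int y)))\<bar>)"
      unfolding L_def by (rule sum_abs)
    also have "\<dots> \<le> int (card {..<q}) * (\<bar>s\<bar> + \<bar>t\<bar>)"
      unfolding H_def by (intro sum_bounded_above abs_horizontal_potential_le)
    finally show ?thesis
      by simp
  qed
  have "k = 0"
  proof (rule bounded_linear_growth_eq_0)
    show "G (x + 1) + L (x + 1) = G x + L x + k" for x
      using column_flux[of x] G(1)[of x] by linarith
    show "\<bar>G x + L x\<bar> \<le> B + int q * (\<bar>s\<bar> + \<bar>t\<bar>)" for x
      using G(2)[of x] L[of x] by linarith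
  qed
  then have "int (a * a + a * b) = int (b * b)"
    by (simp add: k_def)
  then have "a = 0 \<and> b = 0"
    by (intro golden_ratio_irrational_nat) (simp only: of_nat_eq_iff)
  \<comment> \<open>With both values 1 the sum counts all rows: \<open>q = a + b\<close>.\<close>
  then show "q = 0"
    using sum_if_const[of R 1 1 q] by (simp flip: a_def b_def)
qed

lemma period_snd_eq_0:
  assumes valid: "valid_configuration ammann_tiles w" and period: "\<And>n. w (n + p) = w n"
  shows "snd p = 0"
proof (cases "snd p \<ge> 0")
  case True
  then have p: "(fst p, int (nat (snd p))) = p"
    by simp
  have "nat (snd p) = 0"
    by (rule no_period_upwards[OF valid, of "fst p"]) (simp only: p period)
  then show ?thesis
    using True by simp
next
  case False
  then have p: "(fst (- p), int (nat (snd (- p)))) = - p"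
    by (simp add: prod_eq_iff)
  have "w (n + - p) = w n" for n
    using period[of "n + - p"] by simp
  then have "nat (snd (- p)) = 0"
    by (intro no_period_upwards[OF valid, of "fst (- p)"]) (simp only: p)
  then show ?thesis
    using False by simp
qed

definition transpose_tile :: "'a wang_tile \<Rightarrow> 'a wang_tile" where
  "transpose_tile \<tau> = (north \<tau>, east \<tau>, south \<tau>, west \<tau>)"

text \<open>Reflection in the diagonal permutes the sixteen tiles, so rows and columns play
  symmetric roles.\<close>

lemma transpose_tile_in_ammann_tiles:
  "\<tau> \<in> ammann_tiles \<Longrightarrow> transpose_tile \<tau> \<in> ammann_tiles"
  unfolding ammann_tiles_def transpose_tile_def by (elim insertE emptyE) simp_all

lemma valid_configuration_transpose:
  assumes "valid_configuration ammann_tiles w"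
  shows "valid_configuration ammann_tiles (\<lambda>n. transpose_tile (w (prod.swap n)))"
  unfolding valid_configuration_def
proof (intro conjI allI)
  fix n :: "int \<times> int"
  let ?w = "\<lambda>n. transpose_tile (w (prod.swap n))"
  have swap: "prod.swap (n + (i, j)) = prod.swap n + (j, i)" for i j
    by (cases n) simp
  show "?w n \<in> ammann_tiles"
    using assms unfolding valid_configuration_def by (blast intro: transpose_tile_in_ammann_tiles)
  have "north (w (prod.swap n)) = south (w (prod.swap n + (0, 1)))"
    and "east (w (prod.swap n)) = west (w (prod.swap n + (1, 0)))"
    using assms unfolding valid_configuration_def by blast+
  then show "east (?w n) = west (?w (n + (1, 0)))" "north (?w n) = south (?w (n + (0, 1)))"
    by (simp_all only: swap transpose_tile_def east.simps north.simps west.simps south.simps)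
qed

theorem corollary3p4:
  shows "\<not> (\<exists>w. valid_configuration ammann_tiles w \<and> periodic w)"
proof
  assume "\<exists>w. valid_configuration ammann_tiles w \<and> periodic w"
  then obtain w p where valid: "valid_configuration ammann_tiles w"
    and "p \<noteq> 0" and period: "\<And>n. w (n + p) = w n"
    unfolding periodic_def by blast
  have "snd p = 0"
    using valid period by (rule period_snd_eq_0)
  \<comment> \<open>The reflected configuration has the reflected period, which gives
    \<open>fst p = 0\<close>.\<close>
  moreover have "snd (prod.swap p) = 0"
  proof (rule period_snd_eq_0[OF valid_configuration_transpose[OF valid]])
    show "transpose_tile (w (prod.swap (n + prod.swap p))) = transpose_tile (w (prod.swap n))" for n
      using period[of "prod.swap n"] by (cases n; cases p) simp
  qed
  ultimately show False
    using \<open>p \<noteq> 0\<close> by (simp add: prod_eq_iff)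
qed

end
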